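(* Let $\sigma$ be a complex polynomial with $\sigma''=0$ (degree $\le1$), $\sigma\neq0$, and $\kappa_0$ a complex polynomial of degree $\le1$. For $n\in\mathbb{C}$ set $\kappa_n(z):=n\sigma'+\kappa_0(z)$ and $\omega_n:=(n+\frac12)\kappa_0'$. Let $\delta_0$ be a solution of $$\big(\sigma(-\partial_s)s+\kappa_0(-\partial_s)\big)\delta_0(s)=0 .$$ Let $n\in\mathbb{C}$. Assume that the curve $[0,1]\ni\tau\overset{\gamma}{\mapsto}s(\tau)$ satisfies $$\big(s^{n+2}\sigma'+s^{n+1}\kappa_0'\big)\delta_0(s)e^{sz}\Big|_{s(0)}^{s(1)}=0$$ and that the integral $$g_n(z)=\int_\gamma\delta_0(s)s^ne^{zs}\,ds$$ exists. Then $g_n$ is annihilated by $$\mathcal{H}(\sigma,\kappa_n)+\omega_n=\sigma(z)\partial_z^2+\big(\sigma'(n+1)+\kappa_0(z)\big)\partial_z+(n+1)\kappa_0' .$$ Besides, if also $g_{n+1}$ (same formula and same $\gamma$, with $n$ replaced by $n+1$) is well defined, then $$\partial_zg_n(z)=g_{n+1}(z),\qquad \big(\sigma(z)\partial_z+\kappa_{n+1}(z)\big)g_{n+1}(z)=-(n+1)\kappa_0'\,g_n(z).$$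
   Context: $\mathcal{H}(\sigma,\kappa):=\sigma(z)\partial_z^2+(\sigma'(z)+\kappa(z))\partial_z+\frac12\kappa'$. Writing $\sigma(z)=\sigma'z+\sigma(0)$ and $\kappa_0(z)=\kappa_0'z+\kappa_0(0)$ with constants $\sigma',\kappa_0'$, the equation for $\delta_0$ means $-\sigma'\partial_s(s\delta_0(s))+\sigma(0)s\delta_0(s)-\kappa_0'\delta_0'(s)+\kappa_0(0)\delta_0(s)=0$. Contour conventions: $z$ ranges over an open set $U\subset\mathbb{C}$; $\gamma$ is a piecewise smooth curve (independent of $z$) on a Riemann surface on which the multivalued functions of $s$ involved are analytic; these functions are analytically continued along $\gamma$. The notation $f(s)|_{s(0)}^{s(1)}=f(s(1))-f(s(0))$ is the difference of the values at the endpoints of $\gamma$ (limits, if an endpoint is a singular point or infinity), and the boundary condition is assumed for all $z\in U$. "Exists"/"well defined" means that the integral converges and may be differentiated with respect to $z$ under the integral sign as many times as needed (twice). *)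

theory Defs
  imports "HOL-Complex_Analysis.Complex_Analysis"
begin

text \<open>
  Curves are parametrised by the open interval, because either endpoint may be a singular point of
  the functions involved or the point at infinity; the projection to the \<open>s\<close>-plane must have an
  endpoint in the Riemann sphere. For an ordinary endpoint this is the usual piecewise smooth path.
\<close>

definition contour :: "(real \<Rightarrow> complex) \<Rightarrow> bool" where
  "contour \<gamma> \<longleftrightarrow>
     \<gamma> piecewise_C1_differentiable_on {0<..<1} \<and>
     ((\<exists>s0. (\<gamma> \<longlongrightarrow> s0) (at_right 0)) \<or> filterlim \<gamma> at_infinity (at_right 0)) \<and>
     ((\<exists>s1. (\<gamma> \<longlongrightarrow> s1) (at_left 1)) \<or> filterlim \<gamma> at_infinity (at_left 1))"

text \<open>
  A multivalued analytic function on a Riemann surface over the \<open>s\<close>-plane, restricted to a curve on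
  that surface, is a family of germs: \<open>f \<tau>\<close> is the branch near \<open>\<gamma> \<tau>\<close>, and the branches at
  neighbouring parameters agree. Its value at the parameter \<open>\<tau>\<close> is \<open>f \<tau> (\<gamma> \<tau>)\<close>.
\<close>

definition continued_along :: "(real \<Rightarrow> complex) \<Rightarrow> (real \<Rightarrow> complex \<Rightarrow> complex) \<Rightarrow> bool" where
  "continued_along \<gamma> f \<longleftrightarrow>
     (\<forall>\<tau>\<in>{0<..<1}. f \<tau> analytic_on {\<gamma> \<tau>} \<and>
        (\<forall>\<^sub>F t in at \<tau>. \<forall>\<^sub>F s in nhds (\<gamma> t). f t s = f \<tau> s))"

definition log_along :: "(real \<Rightarrow> complex) \<Rightarrow> (real \<Rightarrow> complex \<Rightarrow> complex) \<Rightarrow> bool" where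
  "log_along \<gamma> L \<longleftrightarrow>
     continued_along \<gamma> L \<and>
     (\<forall>\<tau>\<in>{0<..<1}. \<forall>\<^sub>F s in nhds (\<gamma> \<tau>). exp (L \<tau> s) = s)"

text \<open>
  The branch of the power \<open>s\<^sup>m\<close> determined by the branch \<open>L\<close> of the logarithm. For a natural exponent
  (\<open>nat \<lfloor>Re m\<rfloor>\<close> is then \<open>m\<close> itself) no logarithm is needed, and \<open>s = 0\<close> is a regular point.
\<close>

definition power_branch ::
    "(real \<Rightarrow> complex \<Rightarrow> complex) \<Rightarrow> complex \<Rightarrow> real \<Rightarrow> complex \<Rightarrow> complex" where
  "power_branch L m \<tau> s = (if m \<in> \<nat> then s ^ nat \<lfloor>Re m\<rfloor> else exp (m * L \<tau> s))"

definition power_analytic_along ::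
    "(real \<Rightarrow> complex) \<Rightarrow> (real \<Rightarrow> complex \<Rightarrow> complex) \<Rightarrow> complex \<Rightarrow> bool" where
  "power_analytic_along \<gamma> L m \<longleftrightarrow> m \<in> \<nat> \<or> log_along \<gamma> L"

text \<open>The bracket \<open>f(s)\<close> taken between \<open>s(0)\<close> and \<open>s(1)\<close>, the end values being limits that must exist.\<close>

definition has_endpoint_difference :: "(real \<Rightarrow> complex) \<Rightarrow> complex \<Rightarrow> bool" where
  "has_endpoint_difference f v \<longleftrightarrow>
     (\<exists>a b. (f \<longlongrightarrow> a) (at_right 0) \<and> (f \<longlongrightarrow> b) (at_left 1) \<and> v = b - a)"

text \<open>
  The operator \<open>p(-\<partial>\<^sub>s)\<close> for a polynomial \<open>p\<close>.
\<close>

definition poly_neg_deriv :: "complex poly \<Rightarrow> (complex \<Rightarrow> complex) \<Rightarrow> complex \<Rightarrow> complex" where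
  "poly_neg_deriv p f s = (\<Sum>i\<le>degree p. coeff p i * (- 1) ^ i * (deriv ^^ i) f s)"

definition solves_along ::
    "complex poly \<Rightarrow> complex poly \<Rightarrow> (real \<Rightarrow> complex) \<Rightarrow> (real \<Rightarrow> complex \<Rightarrow> complex) \<Rightarrow> bool" where
  "solves_along \<sigma> \<kappa> \<gamma> \<delta> \<longleftrightarrow>
     (\<forall>\<tau>\<in>{0<..<1}. \<forall>\<^sub>F s in nhds (\<gamma> \<tau>).
        poly_neg_deriv \<sigma> (\<lambda>u. u * \<delta> \<tau> u) s + poly_neg_deriv \<kappa> (\<delta> \<tau>) s = 0)"

definition integrand ::
    "(real \<Rightarrow> complex) \<Rightarrow> (real \<Rightarrow> complex \<Rightarrow> complex) \<Rightarrow> (real \<Rightarrow> complex \<Rightarrow> complex) \<Rightarrow>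
     complex \<Rightarrow> complex \<Rightarrow> real \<Rightarrow> complex" where
  "integrand \<gamma> L \<delta> n z \<tau> =
     \<delta> \<tau> (\<gamma> \<tau>) * power_branch L n \<tau> (\<gamma> \<tau>) * exp (z * \<gamma> \<tau>) * vector_derivative \<gamma> (at \<tau>)"

text \<open>
  The Henstock--Kurzweil integral over the unit interval includes the improper (possibly only
  conditionally convergent) integrals arising from singular or infinite endpoints; the values of the
  integrand at the parameters \<open>0\<close> and \<open>1\<close> do not matter.
\<close>

definition g_int ::
    "(real \<Rightarrow> complex) \<Rightarrow> (real \<Rightarrow> complex \<Rightarrow> complex) \<Rightarrow> (real \<Rightarrow> complex \<Rightarrow> complex) \<Rightarrow>
     complex \<Rightarrow> complex \<Rightarrow> complex" where
  "g_int \<gamma> L \<delta> n z = integral {0..1} (integrand \<gamma> L \<delta> n z)"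

text \<open>
  The integral of \<open>f z \<tau>\<close> over \<open>\<tau>\<close> converges for \<open>z\<close> in \<open>U\<close> and can be differentiated \<open>N\<close> times with
  respect to \<open>z\<close> under the integral sign.
\<close>

definition differentiable_under_integral ::
    "nat \<Rightarrow> complex set \<Rightarrow> (complex \<Rightarrow> real \<Rightarrow> complex) \<Rightarrow> bool" where
  "differentiable_under_integral N U f \<longleftrightarrow>
     (\<forall>k\<le>N. \<forall>z\<in>U. (\<lambda>\<tau>. (deriv ^^ k) (\<lambda>w. f w \<tau>) z) integrable_on {0..1}) \<and>
     (\<forall>k<N. \<forall>z\<in>U.
        ((\<lambda>u. integral {0..1} (\<lambda>\<tau>. (deriv ^^ k) (\<lambda>w. f w \<tau>) u)) has_field_derivative
          integral {0..1} (\<lambda>\<tau>. (deriv ^^ Suc k) (\<lambda>w. f w \<tau>) z)) (at z))"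

definition g_well_defined ::
    "complex set \<Rightarrow> (real \<Rightarrow> complex) \<Rightarrow> (real \<Rightarrow> complex \<Rightarrow> complex) \<Rightarrow>
     (real \<Rightarrow> complex \<Rightarrow> complex) \<Rightarrow> complex \<Rightarrow> bool" where
  "g_well_defined U \<gamma> L \<delta> n \<longleftrightarrow> differentiable_under_integral 2 U (integrand \<gamma> L \<delta> n)"

definition H_op ::
    "complex poly \<Rightarrow> complex poly \<Rightarrow> (complex \<Rightarrow> complex) \<Rightarrow> complex \<Rightarrow> complex" where
  "H_op \<sigma> \<kappa> f z =
     poly \<sigma> z * (deriv ^^ 2) f z + (poly (pderiv \<sigma>) z + poly \<kappa> z) * deriv f z
     + 1 / 2 * poly (pderiv \<kappa>) z * f z"

definition kappa_n :: "complex poly \<Rightarrow> complex poly \<Rightarrow> complex \<Rightarrow> complex poly" where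
  "kappa_n \<sigma> \<kappa>0 n = smult n (pderiv \<sigma>) + \<kappa>0"

text \<open>For \<open>p\<close> of degree at most one, the constant \<open>p'\<close> is \<open>coeff p 1\<close>.\<close>

definition omega_n :: "complex poly \<Rightarrow> complex \<Rightarrow> complex" where
  "omega_n \<kappa>0 n = (n + 1 / 2) * coeff \<kappa>0 1"

end

theory Submission
  imports Defs
begin

text \<open>
  By the equation for \<open>\<delta>\<^sub>0\<close>, the operator applied to the integrand \<open>\<delta>\<^sub>0(s) s\<^sup>n e\<^sup>z\<^sup>s\<close> is the \<open>s\<close>-derivative
  of the boundary expression \<open>(s\<^sup>n\<^sup>+\<^sup>2 \<sigma>' + s\<^sup>n\<^sup>+\<^sup>1 \<kappa>\<^sub>0') \<delta>\<^sub>0(s) e\<^sup>s\<^sup>z\<close>, so its integral along \<open>\<gamma>\<close> vanishes.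
  Each \<open>z\<close>-derivative multiplies the integrand by \<open>s\<close>, which raises \<open>n\<close> by one; the recurrence
  relations are thus a rewriting of the differential equation.
\<close>

section \<open>Polynomials of degree at most one and the two differential operators\<close>

lemma poly_degree_le_1:
  fixes p :: "'a::comm_semiring_1 poly"
  assumes "degree p \<le> 1"
  shows "poly p z = coeff p 0 + coeff p 1 * z"
proof -
  have "poly p z = (\<Sum>i\<le>1. coeff p i * z ^ i)"
    unfolding poly_altdef using assms
    by (intro sum.mono_neutral_left) (auto simp: coeff_eq_0)
  then show ?thesis by simp
qed

lemma pderiv_degree_le_1:
  assumes "degree p \<le> 1"
  shows "pderiv p = [:coeff p 1:]"
proof (rule poly_eqI)
  show "coeff (pderiv p) i = coeff [:coeff p 1:] i" for i
    using assms by (cases i) (auto simp: coeff_pderiv coeff_eq_0)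
qed

lemma poly_kappa_n:
  assumes "degree \<sigma> \<le> 1"
  shows "poly (kappa_n \<sigma> \<kappa>0 n) z = n * coeff \<sigma> 1 + poly \<kappa>0 z"
  by (simp add: kappa_n_def pderiv_degree_le_1[OF assms])

text \<open>Only coefficients are compared, so \<open>f\<close> is arbitrary. Since \<sigma>'' = 0,
  the derivative of \<open>kappa_n \<sigma> \<kappa>0 n\<close> is the constant \<kappa>0', and 1/2
  + (n + 1/2) = n + 1 gives the coefficient of order zero.\<close>

lemma H_op_kappa_n:
  assumes "degree \<sigma> \<le> 1" and "degree \<kappa>0 \<le> 1"
  shows "H_op \<sigma> (kappa_n \<sigma> \<kappa>0 n) f z + omega_n \<kappa>0 n * f z =
    poly \<sigma> z * (deriv ^^ 2) f z + (coeff \<sigma> 1 * (n + 1) + poly \<kappa>0 z) * deriv f z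
    + (n + 1) * coeff \<kappa>0 1 * f z"
proof -
  have "poly (pderiv (kappa_n \<sigma> \<kappa>0 n)) z = coeff \<kappa>0 1"
    using assms
    by (simp add: kappa_n_def pderiv_add pderiv_smult pderiv_degree_le_1 pderiv_pCons)
  then show ?thesis
    unfolding H_op_def omega_n_def poly_kappa_n[OF assms(1)] pderiv_degree_le_1[OF assms(1)]
    by (simp add: algebra_simps)
qed

lemma poly_neg_deriv_degree_le_1:
  assumes "degree p \<le> 1"
  shows "poly_neg_deriv p f s = coeff p 0 * f s - coeff p 1 * deriv f s"
proof -
  have "poly_neg_deriv p f s = (\<Sum>i\<le>1. coeff p i * (- 1) ^ i * (deriv ^^ i) f s)"
    unfolding poly_neg_deriv_def using assms
    by (intro sum.mono_neutral_left) (auto simp: coeff_eq_0)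
  then show ?thesis by simp
qed

text \<open>The product rule applied to s \<delta>(s) produces the additional term -\<sigma>'
  \<delta>, whence the subtracted \<open>coeff \<sigma> 1\<close>. Solved for the terms with
  \<delta>', the equation can eliminate them from the derivative of the boundary expression.\<close>

lemma solves_along_first_order:
  assumes "degree \<sigma> \<le> 1" and "degree \<kappa> \<le> 1"
    and "solves_along \<sigma> \<kappa> \<gamma> \<delta>" and "\<tau> \<in> {0<..<1}" and "\<delta> \<tau> analytic_on {\<gamma> \<tau>}"
  shows "(coeff \<sigma> 1 * \<gamma> \<tau> + coeff \<kappa> 1) * deriv (\<delta> \<tau>) (\<gamma> \<tau>) =
    (coeff \<sigma> 0 * \<gamma> \<tau> + coeff \<kappa> 0 - coeff \<sigma> 1) * \<delta> \<tau> (\<gamma> \<tau>)"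
proof -
  have "\<forall>\<^sub>F s in nhds (\<gamma> \<tau>).
      poly_neg_deriv \<sigma> (\<lambda>u. u * \<delta> \<tau> u) s + poly_neg_deriv \<kappa> (\<delta> \<tau>) s = 0"
    using assms(3,4) by (auto simp: solves_along_def)
  then have eq: "poly_neg_deriv \<sigma> (\<lambda>u. u * \<delta> \<tau> u) (\<gamma> \<tau>) + poly_neg_deriv \<kappa> (\<delta> \<tau>) (\<gamma> \<tau>) = 0"
    by (rule eventually_nhds_x_imp_x)
  have "(\<delta> \<tau> has_field_derivative deriv (\<delta> \<tau>) (\<gamma> \<tau>)) (at (\<gamma> \<tau>))"
    using assms(5) by (metis DERIV_deriv_iff_field_differentiable
        analytic_on_imp_differentiable_at singletonI)
  then have "deriv (\<lambda>u. u * \<delta> \<tau> u) (\<gamma> \<tau>) = \<delta> \<tau> (\<gamma> \<tau>) + \<gamma> \<tau> * deriv (\<delta> \<tau>) (\<gamma> \<tau>)"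
    by (intro DERIV_imp_deriv) (auto intro!: derivative_eq_intros)
  with eq show ?thesis
    unfolding poly_neg_deriv_degree_le_1[OF assms(1)] poly_neg_deriv_degree_le_1[OF assms(2)]
    by algebra
qed

section \<open>Powers of s and germs along the curve\<close>

text \<open>For natural m = k the two cases of the definition agree, because exp (k L) = (exp L)^k =
  s^k. This matters for m = -1, where m is not natural but m + 1 is.\<close>

lemma power_branch_eq_exp:
  assumes "exp (L \<tau> s) = s"
  shows "power_branch L m \<tau> s = exp (m * L \<tau> s)"
proof (cases "m \<in> \<nat>")
  case True
  then obtain k where m: "m = of_nat k" by (auto elim: Nats_cases)
  then have "power_branch L m \<tau> s = exp (L \<tau> s) ^ k"
    by (simp add: power_branch_def assms)
  then show ?thesis by (simp add: m exp_of_nat_mult)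
qed (simp add: power_branch_def)

lemma power_branch_of_nat: "power_branch L (of_nat k) \<tau> s = s ^ k"
  by (simp add: power_branch_def)

lemma power_branch_add_1:
  assumes "power_analytic_along \<gamma> L m" and "\<tau> \<in> {0<..<1}"
  shows "power_branch L (m + 1) \<tau> (\<gamma> \<tau>) = power_branch L m \<tau> (\<gamma> \<tau>) * \<gamma> \<tau>"
proof (cases "m \<in> \<nat>")
  case True
  then obtain k where "m = of_nat k" by (auto elim: Nats_cases)
  then show ?thesis
    using power_branch_of_nat[of L k] power_branch_of_nat[of L "Suc k"] by (simp add: add.commute)
next
  case False
  then have "\<forall>\<^sub>F s in nhds (\<gamma> \<tau>). exp (L \<tau> s) = s"
    using assms by (auto simp: power_analytic_along_def log_along_def)
  then have "exp (L \<tau> (\<gamma> \<tau>)) = \<gamma> \<tau>"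
    by (rule eventually_nhds_x_imp_x)
  then show ?thesis
    by (simp add: power_branch_eq_exp distrib_right exp_add)
qed

lemma power_analytic_along_add_1:
  assumes "power_analytic_along \<gamma> L m"
  shows "power_analytic_along \<gamma> L (m + 1)"
  using assms by (auto simp: power_analytic_along_def)

text \<open>The exponent m + 1 is the one differentiated, so that for natural m no negative power
  arises and s = 0 remains a regular point.\<close>

lemma has_field_derivative_power_branch:
  assumes "power_analytic_along \<gamma> L m" and "\<tau> \<in> {0<..<1}"
  shows "(power_branch L (m + 1) \<tau> has_field_derivative (m + 1) * power_branch L m \<tau> (\<gamma> \<tau>))
    (at (\<gamma> \<tau>))"
proof (cases "m \<in> \<nat>")
  case True
  then obtain k where m: "m = of_nat k" by (auto elim: Nats_cases)
  have "power_branch L (m + 1) \<tau> = (\<lambda>s. s ^ Suc k)"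
    using power_branch_of_nat[of L "Suc k"] by (simp add: m add.commute fun_eq_iff)
  then show ?thesis
    using DERIV_power_Suc[OF DERIV_ident, where n = k] by (simp add: m power_branch_of_nat add.commute)
next
  case False
  then have log: "log_along \<gamma> L"
    using assms by (auto simp: power_analytic_along_def)
  then have ev: "\<forall>\<^sub>F s in nhds (\<gamma> \<tau>). exp (L \<tau> s) = s"
    using assms(2) by (auto simp: log_along_def)
  then have e: "exp (L \<tau> (\<gamma> \<tau>)) = \<gamma> \<tau>"
    by (rule eventually_nhds_x_imp_x)
  have "L \<tau> analytic_on {\<gamma> \<tau>}"
    using log assms(2) by (auto simp: log_along_def continued_along_def)
  then obtain D where D: "(L \<tau> has_field_derivative D) (at (\<gamma> \<tau>))"
    by (metis analytic_on_imp_differentiable_at field_differentiable_def singletonI)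
  \<comment> \<open>Near \<open>\<gamma> \<tau>\<close> the function exp L is the identity.
    Comparing its derivative 1 with the chain rule gives s L'(s) = 1 at that point, which lowers the
    exponent m + 1 to m below.\<close>
  then have "((\<lambda>s. exp (L \<tau> s)) has_field_derivative exp (L \<tau> (\<gamma> \<tau>)) * D) (at (\<gamma> \<tau>))"
    by (auto intro!: derivative_eq_intros)
  moreover have "((\<lambda>s. exp (L \<tau> s)) has_field_derivative 1) (at (\<gamma> \<tau>))"
    using DERIV_ident by (subst DERIV_cong_ev[OF refl ev refl])
  ultimately have "exp (L \<tau> (\<gamma> \<tau>)) * D = 1"
    by (rule DERIV_unique)
  then have *: "exp ((m + 1) * L \<tau> (\<gamma> \<tau>)) * D = power_branch L m \<tau> (\<gamma> \<tau>)"
    by (simp add: power_branch_eq_exp e distrib_right exp_add)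
  have "((\<lambda>s. exp ((m + 1) * L \<tau> s)) has_field_derivative
      (m + 1) * (exp ((m + 1) * L \<tau> (\<gamma> \<tau>)) * D)) (at (\<gamma> \<tau>))"
    using D by (auto intro!: derivative_eq_intros)
  moreover have "\<forall>\<^sub>F s in nhds (\<gamma> \<tau>). power_branch L (m + 1) \<tau> s = exp ((m + 1) * L \<tau> s)"
    using ev by eventually_elim (rule power_branch_eq_exp)
  ultimately show ?thesis
    unfolding * by (subst DERIV_cong_ev[OF refl _ refl])
qed

text \<open>Near \<tau> the germ that moves with the parameter can be replaced by the germ at
  \<tau>. This leaves a fixed function of s, to which the chain rule along \<open>\<gamma>\<close>
  applies.\<close>

lemma continued_along_eventually:
  assumes "continued_along \<gamma> f" and "\<tau> \<in> {0<..<1}"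
  shows "\<forall>\<^sub>F t in nhds \<tau>. f t (\<gamma> t) = f \<tau> (\<gamma> t)"
proof -
  have "\<forall>\<^sub>F t in at \<tau>. \<forall>\<^sub>F s in nhds (\<gamma> t). f t s = f \<tau> s"
    using assms by (auto simp: continued_along_def)
  then have "\<forall>\<^sub>F t in at \<tau>. f t (\<gamma> t) = f \<tau> (\<gamma> t)"
    by eventually_elim (rule eventually_nhds_x_imp_x)
  then show ?thesis
    by (auto simp: eventually_nhds_conv_at)
qed

lemma power_branch_eventually:
  assumes "power_analytic_along \<gamma> L m" and "\<tau> \<in> {0<..<1}"
  shows "\<forall>\<^sub>F t in nhds \<tau>. power_branch L m t (\<gamma> t) = power_branch L m \<tau> (\<gamma> t)"
proof (cases "m \<in> \<nat>")
  case True
  then show ?thesis by (simp add: power_branch_def)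
next
  case False
  then have "continued_along \<gamma> L"
    using assms by (auto simp: power_analytic_along_def log_along_def)
  from continued_along_eventually[OF this assms(2)] show ?thesis
    by eventually_elim (simp add: power_branch_def)
qed

section \<open>The fundamental theorem of calculus with limits at the endpoints\<close>

text \<open>Extended by its two one-sided limits, \<open>f\<close> is continuous on the closed
  interval, and the fundamental theorem with finitely many exceptional points applies. For the
  Henstock--Kurzweil integral it also yields the integrability of \<open>f'\<close>, so no absolute
  convergence is required.\<close>

lemma has_integral_endpoint_difference:
  assumes "has_endpoint_difference f v" and "finite T"
    and cont: "\<And>\<tau>. \<tau> \<in> {0<..<1} \<Longrightarrow> isCont f \<tau>"
    and deriv: "\<And>\<tau>. \<tau> \<in> {0<..<1} - T \<Longrightarrow> (f has_vector_derivative f' \<tau>) (at \<tau>)"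
  shows "(f' has_integral v) {0..1}"
proof -
  obtain a b where a: "(f \<longlongrightarrow> a) (at_right 0)" and b: "(f \<longlongrightarrow> b) (at_left 1)" and v: "v = b - a"
    using assms(1) by (auto simp: has_endpoint_difference_def)
  define g where "g \<tau> = (if \<tau> \<le> 0 then a else if \<tau> \<ge> 1 then b else f \<tau>)" for \<tau>
  have g: "\<forall>\<^sub>F t in nhds \<tau>. g t = f t" if "\<tau> \<in> {0<..<1}" for \<tau>
    using eventually_nhds_in_open[OF open_greaterThanLessThan that]
    by eventually_elim (simp add: g_def)
  have "continuous_on {0..1} g"
  proof (rule continuous_on_IccI)
    have "\<forall>\<^sub>F t in at_right 0. g t = f t"
      unfolding eventually_at_right_field by (intro exI[of _ 1]) (auto simp: g_def)
    then show "(g \<longlongrightarrow> g 0) (at_right 0)"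
      using a by (simp add: g_def tendsto_cong)
    have "\<forall>\<^sub>F t in at_left 1. g t = f t"
      unfolding eventually_at_left_field by (intro exI[of _ 0]) (auto simp: g_def)
    then show "(g \<longlongrightarrow> g 1) (at_left 1)"
      using b by (simp add: g_def tendsto_cong)
    show "g \<midarrow>\<tau>\<rightarrow> g \<tau>" if "0 < \<tau>" "\<tau> < 1" for \<tau>
      using cont[of \<tau>] g[of \<tau>] that by (simp add: isCont_cong flip: isCont_def)
  qed simp
  moreover have "(g has_vector_derivative f' \<tau>) (at \<tau>)" if "\<tau> \<in> {0<..<1} - T" for \<tau>
    using deriv[OF that] g[of \<tau>] that
    by (subst has_vector_derivative_cong_ev[where g = f])
      (auto dest: eventually_nhds_x_imp_x elim: eventually_mono)
  ultimately have "(f' has_integral (g 1 - g 0)) {0..1}"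
    by (intro fundamental_theorem_of_calculus_interior_strong[OF \<open>finite T\<close>]) auto
  then show ?thesis by (simp add: g_def v)
qed

section \<open>Differentiation under the integral sign and the shift of n\<close>

text \<open>The variable w enters only through exp (w \<gamma>(\<tau>)), so each derivative brings
  down one factor \<open>\<gamma> \<tau>\<close>, whatever the other factors are.\<close>

lemma deriv_funpow_integrand:
  "(deriv ^^ k) (\<lambda>w. integrand \<gamma> L \<delta> n w \<tau>) = (\<lambda>z. \<gamma> \<tau> ^ k * integrand \<gamma> L \<delta> n z \<tau>)"
proof (induction k)
  case (Suc k)
  have "deriv (\<lambda>z. \<gamma> \<tau> ^ k * integrand \<gamma> L \<delta> n z \<tau>) z = \<gamma> \<tau> ^ Suc k * integrand \<gamma> L \<delta> n z \<tau>" for z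
    unfolding integrand_def by (intro DERIV_imp_deriv) (auto intro!: derivative_eq_intros)
  with Suc show ?case by auto
qed simp

lemma integrand_add_1:
  assumes "power_analytic_along \<gamma> L n" and "\<tau> \<in> {0<..<1}"
  shows "integrand \<gamma> L \<delta> (n + 1) z \<tau> = \<gamma> \<tau> * integrand \<gamma> L \<delta> n z \<tau>"
  by (simp add: integrand_def power_branch_add_1[OF assms])

lemma g_int_add_1:
  assumes "power_analytic_along \<gamma> L n"
  shows "g_int \<gamma> L \<delta> (n + 1) z = integral {0..1} (\<lambda>\<tau>. \<gamma> \<tau> * integrand \<gamma> L \<delta> n z \<tau>)"
  unfolding g_int_def
  \<comment> \<open>The exponent can be shifted for 0 < \<tau> < 1; the two endpoints form a null
    set.\<close>
  by (rule integral_spike[of "{0, 1}"]) (auto simp: integrand_add_1[OF assms])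

lemma g_well_defined_has_integral:
  assumes "g_well_defined U \<gamma> L \<delta> n" and "z \<in> U" and "k \<le> 2"
  shows "((\<lambda>\<tau>. \<gamma> \<tau> ^ k * integrand \<gamma> L \<delta> n z \<tau>) has_integral
    integral {0..1} (\<lambda>\<tau>. \<gamma> \<tau> ^ k * integrand \<gamma> L \<delta> n z \<tau>)) {0..1}"
  using assms
  by (auto simp: g_well_defined_def differentiable_under_integral_def deriv_funpow_integrand)

lemma g_well_defined_has_field_derivative:
  assumes "g_well_defined U \<gamma> L \<delta> n" and "z \<in> U" and "k < 2"
  shows "((\<lambda>u. integral {0..1} (\<lambda>\<tau>. \<gamma> \<tau> ^ k * integrand \<gamma> L \<delta> n u \<tau>)) has_field_derivative
    integral {0..1} (\<lambda>\<tau>. \<gamma> \<tau> ^ Suc k * integrand \<gamma> L \<delta> n z \<tau>)) (at z)"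
  using assms
  unfolding g_well_defined_def differentiable_under_integral_def deriv_funpow_integrand by blast

lemma has_field_derivative_g_int:
  assumes "g_well_defined U \<gamma> L \<delta> n" and "power_analytic_along \<gamma> L n" and "z \<in> U"
  shows "(g_int \<gamma> L \<delta> n has_field_derivative g_int \<gamma> L \<delta> (n + 1) z) (at z)"
  using g_well_defined_has_field_derivative[OF assms(1,3), of 0]
  unfolding g_int_add_1[OF assms(2)] by (simp add: g_int_def[abs_def])

text \<open>As g_{n+1} is the first derivative of g_n, this is the second differentiation under the
  integral sign that the hypothesis on g_n provides.\<close>

lemma has_field_derivative_g_int_add_1:
  assumes "g_well_defined U \<gamma> L \<delta> n" and "power_analytic_along \<gamma> L n" and "z \<in> U"
  shows "(g_int \<gamma> L \<delta> (n + 1) has_field_derivative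
    integral {0..1} (\<lambda>\<tau>. \<gamma> \<tau> ^ 2 * integrand \<gamma> L \<delta> n z \<tau>)) (at z)"
  using g_well_defined_has_field_derivative[OF assms(1,3), of 1]
  by (simp add: g_int_add_1[OF assms(2), abs_def] numeral_2_eq_2)

section \<open>The boundary expression as a primitive\<close>

text \<open>The boundary expression is s^{n+1} (\<sigma>' s + \<kappa>0') \<delta> e^{sz}, so
  \<delta>' occurs with exactly the factor it has in the equation for \<delta>. Eliminating it
  contributes \<sigma>(0), \<kappa>0(0) and -\<sigma>'; the last lowers n + 2 to n + 1. The
  exponential contributes z (\<sigma>' s + \<kappa>0'), which completes the constants to \<sigma>(z)
  and \<kappa>0(z).\<close>

lemma boundary_term_has_field_derivative:
  assumes "degree \<sigma> \<le> 1" and "degree \<kappa>0 \<le> 1"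
    and "continued_along \<gamma> \<delta>" and "solves_along \<sigma> \<kappa>0 \<gamma> \<delta>" and "power_analytic_along \<gamma> L n"
    and "\<tau> \<in> {0<..<1}"
  shows "((\<lambda>s. (power_branch L (n + 2) \<tau> s * coeff \<sigma> 1 + power_branch L (n + 1) \<tau> s * coeff \<kappa>0 1)
      * \<delta> \<tau> s * exp (s * z)) has_field_derivative
    (poly \<sigma> z * \<gamma> \<tau> ^ 2 + (coeff \<sigma> 1 * (n + 1) + poly \<kappa>0 z) * \<gamma> \<tau> + (n + 1) * coeff \<kappa>0 1)
      * (\<delta> \<tau> (\<gamma> \<tau>) * power_branch L n \<tau> (\<gamma> \<tau>) * exp (z * \<gamma> \<tau>))) (at (\<gamma> \<tau>))"
proof -
  let ?P = "power_branch L n \<tau> (\<gamma> \<tau>)" and ?d = "deriv (\<delta> \<tau>) (\<gamma> \<tau>)"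
  note n1 = power_analytic_along_add_1[OF assms(5)]
  have two: "n + 2 = n + 1 + 1" by simp
  have an: "\<delta> \<tau> analytic_on {\<gamma> \<tau>}"
    using assms(3,6) by (auto simp: continued_along_def)
  then have [derivative_intros]: "(\<delta> \<tau> has_field_derivative ?d) (at (\<gamma> \<tau>))"
    by (metis DERIV_deriv_iff_field_differentiable analytic_on_imp_differentiable_at singletonI)
  note [derivative_intros] = has_field_derivative_power_branch[OF assms(5,6)]
    has_field_derivative_power_branch[OF n1 assms(6), folded two]
  have P1: "power_branch L (n + 1) \<tau> (\<gamma> \<tau>) = ?P * \<gamma> \<tau>"
    by (rule power_branch_add_1[OF assms(5,6)])
  have P2: "power_branch L (n + 2) \<tau> (\<gamma> \<tau>) = ?P * \<gamma> \<tau> * \<gamma> \<tau>"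
    unfolding two power_branch_add_1[OF n1 assms(6)] P1 ..
  have ode: "(coeff \<sigma> 1 * \<gamma> \<tau> + coeff \<kappa>0 1) * ?d =
      (coeff \<sigma> 0 * \<gamma> \<tau> + coeff \<kappa>0 0 - coeff \<sigma> 1) * \<delta> \<tau> (\<gamma> \<tau>)"
    by (rule solves_along_first_order[OF assms(1,2,4,6) an])
  \<comment> \<open>The right-hand side is the outcome of the product rule, grouped so that the left
    side of \<open>ode\<close> appears literally. Commuting z past \<open>\<gamma> \<tau>\<close>
    makes the two exponentials the same term.\<close>
  have "(poly \<sigma> z * \<gamma> \<tau> ^ 2 + (coeff \<sigma> 1 * (n + 1) + poly \<kappa>0 z) * \<gamma> \<tau> + (n + 1) * coeff \<kappa>0 1)
      * (\<delta> \<tau> (\<gamma> \<tau>) * ?P * exp (z * \<gamma> \<tau>)) =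
    (((n + 2) * (?P * \<gamma> \<tau>) * coeff \<sigma> 1 + (n + 1) * ?P * coeff \<kappa>0 1) * \<delta> \<tau> (\<gamma> \<tau>)
      + ?P * \<gamma> \<tau> * ((coeff \<sigma> 1 * \<gamma> \<tau> + coeff \<kappa>0 1) * ?d)
      + (?P * \<gamma> \<tau> * \<gamma> \<tau> * coeff \<sigma> 1 + ?P * \<gamma> \<tau> * coeff \<kappa>0 1) * \<delta> \<tau> (\<gamma> \<tau>) * z) * exp (\<gamma> \<tau> * z)"
    unfolding ode poly_degree_le_1[OF assms(1)] poly_degree_le_1[OF assms(2)] mult.commute[of z "\<gamma> \<tau>"]
    by algebra
  then show ?thesis
    by (auto intro!: derivative_eq_intros simp: P1 P2 add.assoc) (simp add: algebra_simps)
qed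

lemma contour_isCont:
  assumes "contour \<gamma>" and "\<tau> \<in> {0<..<1}"
  shows "isCont \<gamma> \<tau>"
  using assms
  by (auto simp: contour_def piecewise_C1_differentiable_on_def continuous_on_eq_continuous_at)

text \<open>Along \<open>\<gamma>\<close> the s-derivative of the boundary expression is multiplied
  by the velocity of the curve, which is the last factor of \<open>integrand\<close>. The integral
  is therefore the endpoint difference \<open>v\<close>.\<close>

lemma g_int_integral_identity:
  assumes "degree \<sigma> \<le> 1" and "degree \<kappa>0 \<le> 1"
    and "contour \<gamma>" and "continued_along \<gamma> \<delta>" and "solves_along \<sigma> \<kappa>0 \<gamma> \<delta>"
    and "power_analytic_along \<gamma> L n"
    and boundary: "has_endpoint_difference
          (\<lambda>\<tau>. (power_branch L (n + 2) \<tau> (\<gamma> \<tau>) * coeff \<sigma> 1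
                + power_branch L (n + 1) \<tau> (\<gamma> \<tau>) * coeff \<kappa>0 1)
               * \<delta> \<tau> (\<gamma> \<tau>) * exp (\<gamma> \<tau> * z)) v"
  shows "((\<lambda>\<tau>. (poly \<sigma> z * \<gamma> \<tau> ^ 2 + (coeff \<sigma> 1 * (n + 1) + poly \<kappa>0 z) * \<gamma> \<tau>
      + (n + 1) * coeff \<kappa>0 1) * integrand \<gamma> L \<delta> n z \<tau>) has_integral v) {0..1}"
proof -
  \<comment> \<open>The parameter selecting the germ and the point s are separate arguments, so that
    s can vary while the germ stays fixed.\<close>
  define \<Phi> where "\<Phi> \<tau> s = (power_branch L (n + 2) \<tau> s * coeff \<sigma> 1
    + power_branch L (n + 1) \<tau> s * coeff \<kappa>0 1) * \<delta> \<tau> s * exp (s * z)" for \<tau> s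
  define D where "D \<tau> = (poly \<sigma> z * \<gamma> \<tau> ^ 2 + (coeff \<sigma> 1 * (n + 1) + poly \<kappa>0 z) * \<gamma> \<tau>
    + (n + 1) * coeff \<kappa>0 1) * (\<delta> \<tau> (\<gamma> \<tau>) * power_branch L n \<tau> (\<gamma> \<tau>) * exp (z * \<gamma> \<tau>))" for \<tau>
  have D: "(\<Phi> \<tau> has_field_derivative D \<tau>) (at (\<gamma> \<tau>))" if "\<tau> \<in> {0<..<1}" for \<tau>
    using boundary_term_has_field_derivative[OF assms(1,2,4,5,6) that]
    unfolding \<Phi>_def D_def .
  note n1 = power_analytic_along_add_1[OF assms(6)]
  note n2 = power_analytic_along_add_1[OF n1, simplified add.assoc one_add_one]
  have germ: "\<forall>\<^sub>F t in nhds \<tau>. \<Phi> t (\<gamma> t) = \<Phi> \<tau> (\<gamma> t)" if "\<tau> \<in> {0<..<1}" for \<tau>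
    using power_branch_eventually[OF n1 that] power_branch_eventually[OF n2 that]
      continued_along_eventually[OF assms(4) that]
    by eventually_elim (simp add: \<Phi>_def)
  obtain T where T: "finite T" "\<gamma> C1_differentiable_on ({0<..<1} - T)"
    using assms(3) by (auto simp: contour_def piecewise_C1_differentiable_on_def)
  \<comment> \<open>Continuity is also needed at the exceptional points in \<open>T\<close>: there
    \<open>\<gamma>\<close> may fail to be differentiable, but it is still continuous.\<close>
  have cont: "isCont (\<lambda>t. \<Phi> t (\<gamma> t)) \<tau>" if "\<tau> \<in> {0<..<1}" for \<tau>
    using isCont_o2[OF contour_isCont[OF assms(3) that] DERIV_isCont[OF D[OF that]]]
    by (subst isCont_cong[OF germ[OF that]])
  have deriv: "((\<lambda>t. \<Phi> t (\<gamma> t)) has_vector_derivative vector_derivative \<gamma> (at \<tau>) * D \<tau>) (at \<tau>)"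
    if "\<tau> \<in> {0<..<1} - T" for \<tau>
  proof -
    have "(\<gamma> has_vector_derivative vector_derivative \<gamma> (at \<tau>)) (at \<tau>)"
      using T(2) that by (metis C1_differentiable_on_eq vector_derivative_works)
    then have "((\<lambda>t. \<Phi> \<tau> (\<gamma> t)) has_vector_derivative vector_derivative \<gamma> (at \<tau>) * D \<tau>) (at \<tau>)"
      using field_vector_diff_chain_at[of \<gamma> _ \<tau>] D[of \<tau>] that by (fastforce simp: o_def)
    then show ?thesis
      using germ[of \<tau>] that
      by (subst has_vector_derivative_cong_ev[where g = "\<lambda>t. \<Phi> \<tau> (\<gamma> t)"])
        (auto elim: eventually_mono)
  qed
  have "((\<lambda>\<tau>. vector_derivative \<gamma> (at \<tau>) * D \<tau>) has_integral v) {0..1}"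
    by (rule has_integral_endpoint_difference[OF _ T(1) cont deriv])
      (use boundary in \<open>auto simp: \<Phi>_def\<close>)
  then show ?thesis
    by (simp add: D_def integrand_def mult_ac)
qed

section \<open>The differential equation and the recurrence relations\<close>

theorem theorem5p2:
  fixes \<sigma> \<kappa>0 :: "complex poly" and n :: complex and U :: "complex set"
    and \<gamma> :: "real \<Rightarrow> complex" and \<delta>0 L :: "real \<Rightarrow> complex \<Rightarrow> complex"
  assumes "degree \<sigma> \<le> 1" and "\<sigma> \<noteq> 0" and "degree \<kappa>0 \<le> 1"
    and "open U"
    and "contour \<gamma>"
    and "continued_along \<gamma> \<delta>0"
    and "solves_along \<sigma> \<kappa>0 \<gamma> \<delta>0"
    and "power_analytic_along \<gamma> L n"
    and boundary: "\<forall>z\<in>U. has_endpoint_difference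
          (\<lambda>\<tau>. (power_branch L (n + 2) \<tau> (\<gamma> \<tau>) * coeff \<sigma> 1
                + power_branch L (n + 1) \<tau> (\<gamma> \<tau>) * coeff \<kappa>0 1)
               * \<delta>0 \<tau> (\<gamma> \<tau>) * exp (\<gamma> \<tau> * z)) 0"
    and "g_well_defined U \<gamma> L \<delta>0 n"
  shows "(\<forall>f z. H_op \<sigma> (kappa_n \<sigma> \<kappa>0 n) f z + omega_n \<kappa>0 n * f z =
            poly \<sigma> z * (deriv ^^ 2) f z + (coeff \<sigma> 1 * (n + 1) + poly \<kappa>0 z) * deriv f z
            + (n + 1) * coeff \<kappa>0 1 * f z)
    \<and> (\<forall>z\<in>U. H_op \<sigma> (kappa_n \<sigma> \<kappa>0 n) (g_int \<gamma> L \<delta>0 n) z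
            + omega_n \<kappa>0 n * g_int \<gamma> L \<delta>0 n z = 0)
    \<and> (g_well_defined U \<gamma> L \<delta>0 (n + 1) \<longrightarrow>
         (\<forall>z\<in>U. (g_int \<gamma> L \<delta>0 n has_field_derivative g_int \<gamma> L \<delta>0 (n + 1) z) (at z) \<and>
            poly \<sigma> z * deriv (g_int \<gamma> L \<delta>0 (n + 1)) z
              + poly (kappa_n \<sigma> \<kappa>0 (n + 1)) z * g_int \<gamma> L \<delta>0 (n + 1) z
              = - (n + 1) * coeff \<kappa>0 1 * g_int \<gamma> L \<delta>0 n z))"
proof (intro conjI allI ballI impI)
  note deg = assms(1,3)
  \<comment> \<open>On \<open>U\<close>, \<open>J 0\<close>, \<open>J 1\<close> and
    \<open>J 2\<close> are g_n and its first two derivatives, so the differential equation and the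
    second recurrence both reduce to one linear relation among them.\<close>
  define J where "J k z = integral {0..1} (\<lambda>\<tau>. \<gamma> \<tau> ^ k * integrand \<gamma> L \<delta>0 n z \<tau>)" for k z
  note wd = \<open>g_well_defined U \<gamma> L \<delta>0 n\<close> and pw = \<open>power_analytic_along \<gamma> L n\<close>
  have J0: "g_int \<gamma> L \<delta>0 n z = J 0 z" for z
    by (simp add: J_def g_int_def)
  have J1: "g_int \<gamma> L \<delta>0 (n + 1) z = J 1 z" for z
    by (simp add: J_def g_int_add_1[OF pw])
  note d0 = has_field_derivative_g_int[OF wd pw]
  have d1: "(g_int \<gamma> L \<delta>0 (n + 1) has_field_derivative J 2 z) (at z)" if "z \<in> U" for z
    unfolding J_def by (rule has_field_derivative_g_int_add_1[OF wd pw that])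
  \<comment> \<open>One integral is evaluated twice: by linearity, from the convergence of the three
    integrals, and as the endpoint difference, which is 0 by assumption.\<close>
  have ode: "poly \<sigma> z * J 2 z + (coeff \<sigma> 1 * (n + 1) + poly \<kappa>0 z) * J 1 z
      + (n + 1) * coeff \<kappa>0 1 * J 0 z = 0" if "z \<in> U" for z
  proof -
    note I = g_well_defined_has_integral[OF wd that, folded J_def]
    have "((\<lambda>\<tau>. poly \<sigma> z * (\<gamma> \<tau> ^ 2 * integrand \<gamma> L \<delta>0 n z \<tau>)
        + (coeff \<sigma> 1 * (n + 1) + poly \<kappa>0 z) * (\<gamma> \<tau> ^ 1 * integrand \<gamma> L \<delta>0 n z \<tau>)
        + (n + 1) * coeff \<kappa>0 1 * (\<gamma> \<tau> ^ 0 * integrand \<gamma> L \<delta>0 n z \<tau>)) has_integral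
        (poly \<sigma> z * J 2 z + (coeff \<sigma> 1 * (n + 1) + poly \<kappa>0 z) * J 1 z
        + (n + 1) * coeff \<kappa>0 1 * J 0 z)) {0..1}"
      by (intro has_integral_add has_integral_mult_right I) auto
    moreover have "((\<lambda>\<tau>. poly \<sigma> z * (\<gamma> \<tau> ^ 2 * integrand \<gamma> L \<delta>0 n z \<tau>)
        + (coeff \<sigma> 1 * (n + 1) + poly \<kappa>0 z) * (\<gamma> \<tau> ^ 1 * integrand \<gamma> L \<delta>0 n z \<tau>)
        + (n + 1) * coeff \<kappa>0 1 * (\<gamma> \<tau> ^ 0 * integrand \<gamma> L \<delta>0 n z \<tau>)) has_integral 0) {0..1}"
      using g_int_integral_identity[OF deg assms(5-8) bspec[OF boundary that]]
      by (simp add: algebra_simps)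
    ultimately show ?thesis by (rule has_integral_unique)
  qed
  fix z
  show "H_op \<sigma> (kappa_n \<sigma> \<kappa>0 n) f z + omega_n \<kappa>0 n * f z =
      poly \<sigma> z * (deriv ^^ 2) f z + (coeff \<sigma> 1 * (n + 1) + poly \<kappa>0 z) * deriv f z
      + (n + 1) * coeff \<kappa>0 1 * f z" for f
    by (rule H_op_kappa_n[OF deg])
  assume z: "z \<in> U"
  \<comment> \<open>Because \<open>U\<close> is open, g_n' = g_{n+1} holds in a neighbourhood of z
    and may be differentiated there.\<close>
  have "deriv (deriv (g_int \<gamma> L \<delta>0 n)) z = deriv (g_int \<gamma> L \<delta>0 (n + 1)) z"
    using eventually_nhds_in_open[OF \<open>open U\<close> z]
    by (intro deriv_cong_ev) (auto elim!: eventually_mono intro: DERIV_imp_deriv d0)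
  then have "(deriv ^^ 2) (g_int \<gamma> L \<delta>0 n) z = J 2 z"
    using DERIV_imp_deriv[OF d1[OF z]] by (simp add: numeral_2_eq_2)
  moreover have "deriv (g_int \<gamma> L \<delta>0 n) z = J 1 z"
    using DERIV_imp_deriv[OF d0[OF z]] J1 by simp
  ultimately show "H_op \<sigma> (kappa_n \<sigma> \<kappa>0 n) (g_int \<gamma> L \<delta>0 n) z
      + omega_n \<kappa>0 n * g_int \<gamma> L \<delta>0 n z = 0"
    using ode[OF z] unfolding H_op_kappa_n[OF deg] J0 by simp
  show "(g_int \<gamma> L \<delta>0 n has_field_derivative g_int \<gamma> L \<delta>0 (n + 1) z) (at z)"
    by (rule d0[OF z])
  \<comment> \<open>The value \<kappa>_{n+1}(z) = (n + 1) \<sigma>' + \<kappa>0(z) is the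
    coefficient of \<open>J 1 z\<close> in \<open>ode\<close>; only the term with g_n changes
    sides.\<close>
  show "poly \<sigma> z * deriv (g_int \<gamma> L \<delta>0 (n + 1)) z
      + poly (kappa_n \<sigma> \<kappa>0 (n + 1)) z * g_int \<gamma> L \<delta>0 (n + 1) z
      = - (n + 1) * coeff \<kappa>0 1 * g_int \<gamma> L \<delta>0 n z"
    using ode[OF z] unfolding poly_kappa_n[OF deg(1)] DERIV_imp_deriv[OF d1[OF z]] J0 J1
    by algebra
qed

end
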